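(* Let $\mathcal{F}_n$ be a finite family of conditional events, $E|H$ a conditional event, and $\mathcal{S}',\mathcal{S}''$ two nonempty subsets of $\mathcal{F}_n$. If $\mathcal{S}'\in\mathcal{K}$ and $\mathcal{S}''\in\mathcal{K}$, then $\mathcal{S}'\cup\mathcal{S}''\in\mathcal{K}$, where $\mathcal{K}=\{\mathcal{S}\subseteq\mathcal{F}_n,\ \mathcal{S}\neq\emptyset:\ \mathcal{C}(\mathcal{S})\subseteq E|H\}$.
   Context: Events are elements of a Boolean algebra with impossible event $\emptyset$; $AB$ is conjunction, $A\vee B$ disjunction, $A^c$ negation, $A\subseteq B$ logical implication. A conditional event $E|H$ is given by events $E,H$ with $H\neq\emptyset$; it is true if $EH$ is true, false if $E^cH$ is true, void if $H^c$ is true. $A|H=B|K$ means $AH=BK$ and $H=K$. Quasi conjunction. For a nonempty finite family $\mathcal{S}=\{E_1|H_1,\ldots,E_s|H_s\}$, $\mathcal{C}(\mathcal{S})$ is the conditional event $\bigwedge_{i=1}^s(E_iH_i\vee H_i^c)\,\big|\,\bigvee_{i=1}^sH_i$. Inclusion (Goodman–Nguyen). $A|H\subseteq B|K$ means $AH\subseteq BK$ and $B^cK\subseteq A^cH$. *)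

theory Defs
  imports Main
begin

text \<open>
  In the one-element Boolean algebra there is no event \<open>H \<noteq> \<bottom>\<close>, hence no conditional event;
  excluding it makes the type of conditional events inhabited and loses nothing.
\<close>

class event_algebra = boolean_algebra +
  assumes bot_neq_top: "bot \<noteq> top"

instance bool :: event_algebra
  by standard simp

definition cond_rel :: "'a::event_algebra \<times> 'a \<Rightarrow> 'a \<times> 'a \<Rightarrow> bool" where
  "cond_rel = (\<lambda>(A, H) (B, K). H \<noteq> bot \<and> K \<noteq> bot \<and> inf A H = inf B K \<and> H = K)"

lemma part_equivp_cond_rel: "part_equivp (cond_rel :: 'a::event_algebra \<times> 'a \<Rightarrow> _)"
proof (rule part_equivpI)
  show "\<exists>x :: 'a \<times> 'a. cond_rel x x"
    by (rule exI[of _ "(top, top)"]) (simp add: cond_rel_def bot_neq_top[symmetric])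
  show "symp (cond_rel :: 'a \<times> 'a \<Rightarrow> _)" by (auto simp: symp_def cond_rel_def)
  show "transp (cond_rel :: 'a \<times> 'a \<Rightarrow> _)" by (auto simp: transp_def cond_rel_def)
qed

quotient_type (overloaded) 'a cond_event = "'a::event_algebra \<times> 'a" / partial: cond_rel
  by (rule part_equivp_cond_rel)

text \<open>\<open>Cond E H\<close> is $E|H$; its value is junk for \<open>H = \<bottom>\<close>.\<close>

lift_definition Cond :: "'a::event_algebra \<Rightarrow> 'a \<Rightarrow> 'a cond_event"
  is "\<lambda>E H. if H = bot then (top, top) else (E, H)"
  by (simp add: cond_rel_def bot_neq_top[symmetric])

lemma Cond_eq_iff:
  assumes "H \<noteq> bot" "K \<noteq> bot"
  shows "Cond A H = Cond B K \<longleftrightarrow> inf A H = inf B K \<and> H = K"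
  using assms by transfer (simp add: cond_rel_def)

lemma Cond_cases:
  obtains E H where "X = Cond E H" "H \<noteq> bot"
proof -
  have "\<exists>E H. X = Cond E H \<and> H \<noteq> bot"
    by transfer (auto simp: cond_rel_def)
  then show thesis using that by blast
qed

text \<open>The events $EH$ and $H$ do not depend on the representation of $E|H$, whereas $E$ does.\<close>

lift_definition true_part :: "'a::event_algebra cond_event \<Rightarrow> 'a"
  is "\<lambda>(E, H). inf E H"
  by (auto simp: cond_rel_def)

lift_definition antecedent :: "'a::event_algebra cond_event \<Rightarrow> 'a"
  is "\<lambda>(E, H). H"
  by (auto simp: cond_rel_def)

lemma true_part_Cond [simp]: "H \<noteq> bot \<Longrightarrow> true_part (Cond E H) = inf E H"
  by transfer simp

lemma antecedent_Cond [simp]: "H \<noteq> bot \<Longrightarrow> antecedent (Cond E H) = H"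
  by transfer simp

text \<open>Meaningful for finite nonempty \<open>S\<close> only.\<close>

definition quasi_conj :: "'a::event_algebra cond_event set \<Rightarrow> 'a cond_event" where
  "quasi_conj S = Cond (Inf_fin ((\<lambda>X. sup (true_part X) (- antecedent X)) ` S))
                       (Sup_fin (antecedent ` S))"

lemma quasi_conj_Cond:
  assumes "\<And>i. i \<in> I \<Longrightarrow> H i \<noteq> bot"
  shows "quasi_conj ((\<lambda>i. Cond (E i) (H i)) ` I) =
    Cond (Inf_fin ((\<lambda>i. sup (inf (E i) (H i)) (- H i)) ` I)) (Sup_fin (H ` I))"
proof -
  have "(\<lambda>X. sup (true_part X) (- antecedent X)) ` (\<lambda>i. Cond (E i) (H i)) ` I =
      (\<lambda>i. sup (inf (E i) (H i)) (- H i)) ` I"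
    unfolding image_image using assms by (intro image_cong) simp_all
  moreover have "antecedent ` (\<lambda>i. Cond (E i) (H i)) ` I = H ` I"
    unfolding image_image using assms by (intro image_cong) simp_all
  ultimately show ?thesis by (simp add: quasi_conj_def)
qed

lemma antecedent_neq_bot: "antecedent X \<noteq> bot"
  by transfer (auto simp: cond_rel_def)

lemma quasi_conj_antecedent_neq_bot:
  assumes "finite S" "S \<noteq> {}"
  shows "Sup_fin (antecedent ` S) \<noteq> bot"
proof -
  obtain X where "X \<in> S" using assms(2) by blast
  then have "antecedent X \<le> Sup_fin (antecedent ` S)"
    using assms(1) by (intro Sup_fin.coboundedI) auto
  then show ?thesis using antecedent_neq_bot[of X] by (auto simp: bot_unique)
qed

lemma inf_compl_eqI:
  fixes A B H :: "'a::boolean_algebra"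
  assumes "inf A H = inf B H"
  shows "inf (- A) H = inf (- B) H"
proof -
  have *: "inf (- C) H = inf (- inf C H) H" for C :: 'a
    by (simp add: inf_sup_distrib2)
  show ?thesis by (subst (1 2) *) (simp only: assms)
qed

lift_definition gn_le :: "'a::event_algebra cond_event \<Rightarrow> 'a cond_event \<Rightarrow> bool"
  is "\<lambda>(A, H) (B, K). inf A H \<le> inf B K \<and> inf (- B) K \<le> inf (- A) H"
proof -
  fix p p' q q' :: "'a \<times> 'a"
  assume r: "cond_rel p p'" "cond_rel q q'"
  obtain A H A' H' B K B' K' where
    eqs: "p = (A, H)" "p' = (A', H')" "q = (B, K)" "q' = (B', K')"
    by (metis surj_pair)
  have a: "inf A H = inf A' H" "H' = H" and b: "inf B K = inf B' K" "K' = K"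
    using r unfolding eqs cond_rel_def by auto
  show "(case p of (A, H) \<Rightarrow> \<lambda>(B, K). inf A H \<le> inf B K \<and> inf (- B) K \<le> inf (- A) H) q \<longleftrightarrow>
      (case p' of (A, H) \<Rightarrow> \<lambda>(B, K). inf A H \<le> inf B K \<and> inf (- B) K \<le> inf (- A) H) q'"
    unfolding eqs prod.case a b inf_compl_eqI[OF a(1)] inf_compl_eqI[OF b(1)] ..
qed

lemma gn_le_Cond:
  assumes "H \<noteq> bot" "K \<noteq> bot"
  shows "gn_le (Cond A H) (Cond B K) \<longleftrightarrow>
    inf A H \<le> inf B K \<and> inf (- B) K \<le> inf (- A) H"
  using assms by transfer simp

definition implying_subfamilies ::
  "'a::event_algebra cond_event set \<Rightarrow> 'a cond_event \<Rightarrow> 'a cond_event set set" where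
  "implying_subfamilies F X = {S. S \<subseteq> F \<and> S \<noteq> {} \<and> gn_le (quasi_conj S) X}"

end

theory Submission
  imports Defs
begin

text \<open>
  Write \<open>M S\<close> for the meet of the material conditionals \<open>EH \<squnion> -H\<close> over a family \<open>S\<close> and
  \<open>V S\<close> for the join of its antecedents, so that the quasi conjunction is \<open>M S | V S\<close>.
  Passing from two families to their union turns \<open>M\<close> into a meet and \<open>V\<close> into a join.
  Hence the quasi conjunction of the union can be true only where one of the two quasi
  conjunctions is true, as not all of its members are void there; and it is false wherever
  one of the two is false. Inclusion in \<open>E|H\<close> bounds the event of being true from above by
  \<open>EH\<close> and the event of being false from below by \<open>(-E)H\<close>, so both bounds carry over.
\<close>

text \<open>
  The join of the antecedents of a nonempty family is a possible event, so the representative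
  \<open>(M, V)\<close> of the quasi conjunction can be read off.
\<close>

lemma gn_le_quasi_conj_iff:
  assumes "finite S" "S \<noteq> {}" "H \<noteq> bot"
  defines "M \<equiv> Inf_fin ((\<lambda>X. sup (true_part X) (- antecedent X)) ` S)"
    and "V \<equiv> Sup_fin (antecedent ` S)"
  shows "gn_le (quasi_conj S) (Cond E H) \<longleftrightarrow>
    inf M V \<le> inf E H \<and> inf (- E) H \<le> inf (- M) V"
  unfolding quasi_conj_def M_def V_def
  by (rule gn_le_Cond[OF quasi_conj_antecedent_neq_bot[OF assms(1,2)] assms(3)])

lemma gn_le_quasi_conj_Un:
  assumes fin: "finite S" "finite T" and ne: "S \<noteq> {}" "T \<noteq> {}"
    and "gn_le (quasi_conj S) X" "gn_le (quasi_conj T) X"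
  shows "gn_le (quasi_conj (S \<union> T)) X"
proof -
  obtain E H where X: "X = Cond E H" and H: "H \<noteq> bot"
    by (rule Cond_cases)
  define M where "M R = Inf_fin ((\<lambda>Y. sup (true_part Y) (- antecedent Y)) ` R)"
    for R :: "'a cond_event set"
  define V where "V R = Sup_fin (antecedent ` R)" for R :: "'a cond_event set"
  have iff: "gn_le (quasi_conj R) X \<longleftrightarrow>
      inf (M R) (V R) \<le> inf E H \<and> inf (- E) H \<le> inf (- M R) (V R)"
    if "finite R" "R \<noteq> {}" for R
    unfolding X M_def V_def by (rule gn_le_quasi_conj_iff[OF that H])
  have M_Un: "M (S \<union> T) = inf (M S) (M T)"
    unfolding M_def image_Un by (rule Inf_fin.union) (use fin ne in auto)
  have V_Un: "V (S \<union> T) = sup (V S) (V T)"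
    unfolding V_def image_Un by (rule Sup_fin.union) (use fin ne in auto)
  have S: "inf (M S) (V S) \<le> inf E H" "inf (- E) H \<le> inf (- M S) (V S)"
    and T: "inf (M T) (V T) \<le> inf E H"
    using assms iff by auto
  have "inf (M (S \<union> T)) (V (S \<union> T)) \<le> sup (inf (M S) (V S)) (inf (M T) (V T))"
    unfolding M_Un V_Un inf_sup_distrib1 by (intro sup_mono inf_mono) simp_all
  also have "\<dots> \<le> inf E H"
    using S(1) T by (rule sup_least)
  finally have true_le: "inf (M (S \<union> T)) (V (S \<union> T)) \<le> inf E H" .
  have "inf (- E) H \<le> inf (- M S) (V S)"
    by (rule S(2))
  also have "\<dots> \<le> inf (- M (S \<union> T)) (V (S \<union> T))"
    unfolding M_Un V_Un by (intro inf_mono) simp_all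
  finally have "inf (- E) H \<le> inf (- M (S \<union> T)) (V (S \<union> T))" .
  with true_le show ?thesis
    using fin ne by (simp add: iff)
qed

theorem theorem10:
  fixes F S' S'' :: "'a::event_algebra cond_event set" and E H :: 'a
  assumes "finite F" and "H \<noteq> bot"
    and "S' \<subseteq> F" and "S' \<noteq> {}" and "S'' \<subseteq> F" and "S'' \<noteq> {}"
    and "S' \<in> implying_subfamilies F (Cond E H)"
    and "S'' \<in> implying_subfamilies F (Cond E H)"
  shows "S' \<union> S'' \<in> implying_subfamilies F (Cond E H)"
proof -
  have "finite S'" "finite S''"
    using assms by (auto intro: finite_subset)
  then have "gn_le (quasi_conj (S' \<union> S'')) (Cond E H)"
    using assms by (intro gn_le_quasi_conj_Un) (auto simp: implying_subfamilies_def)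
  then show ?thesis
    using assms by (simp add: implying_subfamilies_def)
qed

end
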